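(* Let $\Xi$ be the suspension process over $(\Omega,\mathcal{F},\mathbb{P},\theta)$ with roof function $\tau$, on the suspension space $(\bar\Omega,\bar{\mathcal{F}},\bar{\mathbb{P}})$, with $\bar\tau=\int\tau\,\mathrm{d}\mathbb{P}$; let $\xi$ be the induced discrete-time process, $\Delta(n)=\mathbf{E}(\xi(0)\otimes\xi(n))$, and let $(S_N,\mathbb{S}_N)$ and $(\bar S_N,\bar{\mathbb{S}}_N)$ be the associated rescaled sums and integrals with their iterated sums and integrals (all as defined in the context). Assume: (a) $\mathbf{E}\,\xi(0)=0$, $\Delta(0)$ and $\sum_{n=1}^\infty\Delta(n)$ are finite, and the iterated invariance principle holds for $(S_N,\mathbb{S}_N)$ with Brownian rough path limit $(B,\mathbb{B})$ with characteristics \[ \Sigma=\Delta(0)+2\,\mathrm{Sym}(\Gamma),\qquad \Gamma=\sum_{n=1}^\infty\Delta(n). \] (b) The iterated invariance principle holds for $(\bar S_N,\bar{\mathbb{S}}_N)$ with Brownian rough path limit $(\bar B,\bar{\mathbb{B}})$ such that \[ \bar B=(\bar\tau)^{-1/2}B, \] \[ \bar{\mathbb{B}}(t)=\int_0^t\bar B\otimes\mathrm{d}\bar B+t\,(\bar\tau)^{-1}\Gamma+t\int_{\bar\Omega}\Big(\int_0^u\Xi(s;\omega)\,\mathrm{d}s\Big)\otimes\Xi(0;(\omega,u))\,\mathrm{d}\bar{\mathbb{P}}(\omega,u), \] where the first integral is in the sense of Itô. Then the Brownian rough path limit $(\bar B,\bar{\mathbb{B}})$ has the characteristics $(\bar\Sigma,\bar\Gamma)$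 given by \[ \bar\Sigma=(\bar\tau)^{-1}\Sigma,\qquad \bar\Gamma=(\bar\tau)^{-1}\Gamma+\int_{\bar\Omega}\Big(\int_0^u\Xi(s;\omega)\,\mathrm{d}s\Big)\otimes\Xi(0;(\omega,u))\,\mathrm{d}\bar{\mathbb{P}}(\omega,u), \] and the area correction \[ \bar{\mathbb{B}}(1)=\int_0^1\bar B\otimes\circ\,\mathrm{d}\bar B+\mathrm{Anti}(\bar\Gamma), \] where the last stochastic integral is in the sense of Stratonovich.
   Context: Conventions: $(x\otimes y)^{i,j}=x^iy^j$ for $x,y\in\mathbb{R}^d$; $(\mathbb{R}^d)^{\otimes 2}$ is identified with $d\times d$ matrices; expectations and integrals of vectors and matrices are taken component-wise; $\mathrm{Sym}(M)=\frac12(M+M^T)$ and $\mathrm{Anti}(M)=\frac12(M-M^T)$ are the symmetric and antisymmetric parts of $M$; $[x]$ is the integer part of $x$. Brownian rough path: a Brownian rough path over $\mathbb{R}^d$ with characteristics $(\Sigma,\Gamma)\in(\mathbb{R}^d)^{\otimes2}\times(\mathbb{R}^d)^{\otimes2}$ is any process $t\mapsto(B(t),\mathbb{B}(t))$, where $B$ is a $d$-dimensional Brownian motion with covariance $\Sigma=\mathbf{E}(B(1)\otimes B(1))$ and $\mathbb{B}(t)=\int_0^tB\otimes\mathrm{d}B+t\Gamma$, i.e. $\mathbb{B}^{i,j}(t)=\int_0^tB^i(s)\,\mathrm{d}B^j(s)+t\,\Gamma^{i,j}$, with the integral in the sense of Itô. In particular $\Gamma=\mathbf{E}(\mathbb{B}(1))$.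 Iterated invariance principle: let $t\mapsto(S_N(t),\mathbb{S}_N(t))$, $N\ge1$, be random processes on $\mathbb{R}^d\times(\mathbb{R}^d)^{\otimes2}$. The iterated invariance principle holds for $(S_N,\mathbb{S}_N)$ with Brownian rough path limit $(B,\mathbb{B})$ if (1) for all $t$, the sequence $(S_N(t),\mathbb{S}_N(t))$ converges in law to $(B(t),\mathbb{B}(t))$ as $N\to\infty$; and (2) $\mathbf{E}(S_N(1)\otimes S_N(1))\to\mathbf{E}(B(1)\otimes B(1))$ and $\mathbf{E}(\mathbb{S}_N(1))\to\mathbf{E}(\mathbb{B}(1))$. Suspension setting: $(\Omega,\mathcal{F},\mathbb{P})$ is a complete probability space, $\theta:\Omega\to\Omega$ is a $\mathbb{P}$-preserving transformation, and $\tau:\Omega\to(0,\infty)$ is a (measurable) roof function with $L^{-1}\le\tau\le L$ for some $L>0$. The suspension space is \[ \bar\Omega=\{(\omega,t):\omega\in\Omega,\ 0\le t\le\tau(\omega),\ (\omega,\tau(\omega))=(\theta\omega,0)\} \] (i.e. $(\omega,\tau(\omega))$ is identified with $(\theta\omega,0)$), $\bar{\mathcal{F}}$ is the restriction to $\bar\Omega$ of $\mathcal{F}\times\mathcal{B}([0,L])$ with $\mathcal{B}([0,L])$ the Borel $\sigma$-algebra, $\bar\tau=\int\tau\,\mathrm{d}\mathbb{P}$, and for $A\in\bar{\mathcal{F}}$ \[ \bar{\mathbb{P}}(A)=\frac1{\bar\tau}\int_{\bar\Omega}\mathbf{1}_A(\omega,t)\,\mathrm{d}\mathbb{P}(\omega)\,\mathrm{d}t.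 \] The suspension process $\Xi$ is a $d$-dimensional continuous-time process on $\bar\Omega$, satisfying, for $t\ge0$ and $(\omega,s)\in\bar\Omega$, \[ \Xi(t;(\omega,s))=\Xi(t+s;(\omega,0))=\Xi(0;(\omega,t+s))\quad\text{if }0\le t+s<\tau(\omega), \] \[ \Xi(t;(\omega,s))=\Xi(0;(\theta^k\omega,u))\quad\text{if }t+s=u+\sum_{j=0}^{k-1}\tau(\theta^j\omega),\ 0\le u<\tau(\theta^k\omega),\ k\ge1. \] It is a stationary process on $(\bar\Omega,\bar{\mathcal{F}},\bar{\mathbb{P}})$. One writes $\Xi(t;\omega)$ for $\Xi(t;(\omega,0))$; thus $\Xi(0;(\omega,u))=\Xi(u;\omega)$ for $0\le u<\tau(\omega)$. Induced processes: on $(\Omega,\mathcal{F},\mathbb{P})$ set $\xi(0;\omega)=\int_0^{\tau(\omega)}\Xi(s;\omega)\,\mathrm{d}s$ and $\xi(k;\omega)=\xi(0;\theta^k\omega)$ for $k\ge0$, and $\Delta(n)=\mathbf{E}(\xi(0)\otimes\xi(n))$ for $n\ge 0$, the expectation being with respect to $\mathbb{P}$. Put \[ S_N(t)=\frac1{N^{1/2}}\sum_{0\le k<[Nt]}\xi(k),\qquad \mathbb{S}_N(t)=\frac1N\sum_{0\le k<\ell<[Nt]}\xi(k)\otimes\xi(\ell), \] \[ \bar S_N(t)=\frac1{N^{1/2}}\int_0^{Nt}\Xi(s)\,\mathrm{d}s,\qquad \bar{\mathbb{S}}_N(t)=\int_0^t\bar S_N(s)\otimes\mathrm{d}\bar S_N(s)\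 \text{(Riemann--Stieltjes)}. \] It is understood that all integrals appearing in these definitions and in the claim are well-defined. *)

theory Defs
  imports "HOL-Probability.Probability"
begin

section \<open>Tensors\<close>

definition tensor :: "real ^ 'd \<Rightarrow> real ^ 'd \<Rightarrow> real ^ 'd ^ 'd" (infixl "\<otimes>\<^sub>T" 75)
  where "x \<otimes>\<^sub>T y = (\<chi> i j. x $ i * y $ j)"

definition sym_part :: "real ^ 'd ^ 'd \<Rightarrow> real ^ 'd ^ 'd"
  where "sym_part M = (1/2) *\<^sub>R (M + transpose M)"

definition anti_part :: "real ^ 'd ^ 'd \<Rightarrow> real ^ 'd ^ 'd"
  where "anti_part M = (1/2) *\<^sub>R (M - transpose M)"


section \<open>Convergence of random variables\<close>

definition converges_in_law ::
  "'a measure \<Rightarrow> (nat \<Rightarrow> 'a \<Rightarrow> 'c::topological_space) \<Rightarrow> 'b measure \<Rightarrow> ('b \<Rightarrow> 'c) \<Rightarrow> bool"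
  where "converges_in_law M X Q Y \<longleftrightarrow>
    (\<forall>f :: 'c \<Rightarrow> real. continuous_on UNIV f \<longrightarrow> bounded (range f) \<longrightarrow>
      (\<lambda>n. \<integral>\<omega>. f (X n \<omega>) \<partial>M) \<longlonglongrightarrow> (\<integral>\<omega>. f (Y \<omega>) \<partial>Q))"

definition converges_in_probability ::
  "'a measure \<Rightarrow> (nat \<Rightarrow> 'a \<Rightarrow> real) \<Rightarrow> ('a \<Rightarrow> real) \<Rightarrow> bool"
  where "converges_in_probability M X Y \<longleftrightarrow>
    (\<forall>\<epsilon>>0. (\<lambda>n. measure M {\<omega> \<in> space M. \<epsilon> \<le> \<bar>X n \<omega> - Y \<omega>\<bar>}) \<longlonglongrightarrow> 0)"


section \<open>Riemann--Stieltjes integral\<close>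

definition has_rs_integral ::
  "(real \<Rightarrow> real) \<Rightarrow> (real \<Rightarrow> real) \<Rightarrow> real \<Rightarrow> real \<Rightarrow> real \<Rightarrow> bool"
  where "has_rs_integral f g a b I \<longleftrightarrow>
    (\<forall>\<epsilon>>0. \<exists>\<delta>>0. \<forall>p. p tagged_division_of {a..b} \<longrightarrow> (\<lambda>x. ball x \<delta>) fine p \<longrightarrow>
      \<bar>(\<Sum>(x, k)\<in>p. f x * (g (Sup k) - g (Inf k))) - I\<bar> < \<epsilon>)"

definition rs_integral :: "real \<Rightarrow> real \<Rightarrow> (real \<Rightarrow> real) \<Rightarrow> (real \<Rightarrow> real) \<Rightarrow> real"
  where "rs_integral a b f g =
    (if \<exists>I. has_rs_integral f g a b I then THE I. has_rs_integral f g a b I else 0)"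


section \<open>Brownian motion\<close>

definition centered_normal_law :: "real \<Rightarrow> real measure"
  where "centered_normal_law v =
    (if v = 0 then return borel 0 else density lborel (normal_density 0 (sqrt v)))"

text \<open>\<open>C\<close> may be degenerate, so the law is specified through its one-dimensional projections.\<close>

definition centered_gaussian :: "'b measure \<Rightarrow> ('b \<Rightarrow> real ^ 'd) \<Rightarrow> real ^ 'd ^ 'd \<Rightarrow> bool"
  where "centered_gaussian Q X C \<longleftrightarrow>
    X \<in> borel_measurable Q \<and> transpose C = C \<and>
    (\<forall>u. 0 \<le> u \<bullet> (C *v u) \<and>
      distr Q borel (\<lambda>\<omega>. u \<bullet> X \<omega>) = centered_normal_law (u \<bullet> (C *v u)))"

definition brownian_motion ::
  "'b measure \<Rightarrow> (real \<Rightarrow> 'b \<Rightarrow> real ^ 'd) \<Rightarrow> real ^ 'd ^ 'd \<Rightarrow> bool"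
  where "brownian_motion Q B \<Sigma> \<longleftrightarrow>
    prob_space Q \<and>
    (\<forall>t\<ge>0. B t \<in> borel_measurable Q) \<and>
    (AE \<omega> in Q. B 0 \<omega> = 0) \<and>
    (AE \<omega> in Q. continuous_on {0..} (\<lambda>t. B t \<omega>)) \<and>
    (\<forall>s t. 0 \<le> s \<longrightarrow> s \<le> t \<longrightarrow> centered_gaussian Q (\<lambda>\<omega>. B t \<omega> - B s \<omega>) ((t - s) *\<^sub>R \<Sigma>)) \<and>
    (\<forall>(n::nat) p. 0 \<le> p 0 \<longrightarrow> (\<forall>k<n. p k \<le> p (Suc k)) \<longrightarrow>
      prob_space.indep_vars Q (\<lambda>_. borel) (\<lambda>k \<omega>. B (p (Suc k)) \<omega> - B (p k) \<omega>) {..<n})"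

definition natural_filtration ::
  "'b measure \<Rightarrow> (real \<Rightarrow> 'b \<Rightarrow> 'c::topological_space) \<Rightarrow> real \<Rightarrow> 'b measure"
  where "natural_filtration Q B t =
    sigma (space Q) (\<Union>s\<in>{0..t}. {B s -` A \<inter> space Q | A. A \<in> sets borel})"


section \<open>Stochastic integrals\<close>

definition is_partition :: "real \<Rightarrow> real \<Rightarrow> nat \<Rightarrow> (nat \<Rightarrow> real) \<Rightarrow> bool"
  where "is_partition a b n p \<longleftrightarrow> p 0 = a \<and> p n = b \<and> (\<forall>k<n. p k \<le> p (Suc k))"

definition mesh :: "nat \<Rightarrow> (nat \<Rightarrow> real) \<Rightarrow> real"
  where "mesh n p = Max (insert 0 ((\<lambda>k. p (Suc k) - p k) ` {..<n}))"

definition elementary_process ::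
  "nat \<Rightarrow> (nat \<Rightarrow> real) \<Rightarrow> (nat \<Rightarrow> 'b \<Rightarrow> real) \<Rightarrow> real \<Rightarrow> 'b \<Rightarrow> real"
  where "elementary_process n p h s \<omega> = (\<Sum>k<n. h k \<omega> * indicator {p k<..p (Suc k)} s)"

definition elementary_integral ::
  "nat \<Rightarrow> (nat \<Rightarrow> real) \<Rightarrow> (nat \<Rightarrow> 'b \<Rightarrow> real) \<Rightarrow> (real \<Rightarrow> 'b \<Rightarrow> real) \<Rightarrow> 'b \<Rightarrow> real"
  where "elementary_integral n p h Y \<omega> = (\<Sum>k<n. h k \<omega> * (Y (p (Suc k)) \<omega> - Y (p k) \<omega>))"

text \<open>\<open>I\<close> is a version of the Ito integral of \<open>X\<close> against \<open>Y\<close> over \<open>[0, t]\<close>, defined by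
  mean-square approximation of \<open>X\<close> by bounded elementary processes adapted to \<open>F\<close>.  It is meant
  for \<open>F\<close>-adapted square-integrable \<open>X\<close> and for \<open>Y\<close> a Brownian motion whose future increments
  are independent of \<open>F\<close>; then \<open>I\<close> is unique up to null sets.\<close>

definition is_ito_integral ::
  "'b measure \<Rightarrow> (real \<Rightarrow> 'b measure) \<Rightarrow> (real \<Rightarrow> 'b \<Rightarrow> real) \<Rightarrow> (real \<Rightarrow> 'b \<Rightarrow> real) \<Rightarrow>
    real \<Rightarrow> ('b \<Rightarrow> real) \<Rightarrow> bool"
  where "is_ito_integral Q F X Y t I \<longleftrightarrow>
    I \<in> borel_measurable Q \<and>
    (\<exists>n p h.
      (\<forall>m. is_partition 0 t (n m) (p m) \<and>
        (\<forall>k<n m. h m k \<in> borel_measurable (F (p m k)) \<and> bounded (h m k ` space Q))) \<and>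
      (\<lambda>m. \<integral>\<^sup>+\<omega>. (\<integral>\<^sup>+s\<in>{0..t}.
        ennreal ((elementary_process (n m) (p m) (h m) s \<omega> - X s \<omega>)\<^sup>2) \<partial>lborel) \<partial>Q)
        \<longlonglongrightarrow> 0 \<and>
      (\<lambda>m. \<integral>\<^sup>+\<omega>. ennreal ((elementary_integral (n m) (p m) (h m) Y \<omega> - I \<omega>)\<^sup>2) \<partial>Q)
        \<longlonglongrightarrow> 0)"

definition is_quadratic_covariation ::
  "'b measure \<Rightarrow> (real \<Rightarrow> 'b \<Rightarrow> real) \<Rightarrow> (real \<Rightarrow> 'b \<Rightarrow> real) \<Rightarrow> real \<Rightarrow> ('b \<Rightarrow> real) \<Rightarrow> bool"
  where "is_quadratic_covariation Q X Y t V \<longleftrightarrow>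
    V \<in> borel_measurable Q \<and>
    (\<forall>n p. (\<forall>m. is_partition 0 t (n m) (p m)) \<longrightarrow> (\<lambda>m. mesh (n m) (p m)) \<longlonglongrightarrow> 0 \<longrightarrow>
      converges_in_probability Q
        (\<lambda>m \<omega>. \<Sum>k<n m. (X (p m (Suc k)) \<omega> - X (p m k) \<omega>) * (Y (p m (Suc k)) \<omega> - Y (p m k) \<omega>))
        V)"

text \<open>The Fisk--Stratonovich integral: Ito integral plus half the quadratic covariation.\<close>

definition is_stratonovich_integral ::
  "'b measure \<Rightarrow> (real \<Rightarrow> 'b measure) \<Rightarrow> (real \<Rightarrow> 'b \<Rightarrow> real) \<Rightarrow> (real \<Rightarrow> 'b \<Rightarrow> real) \<Rightarrow>
    real \<Rightarrow> ('b \<Rightarrow> real) \<Rightarrow> bool"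
  where "is_stratonovich_integral Q F X Y t J \<longleftrightarrow>
    (\<exists>I V. is_ito_integral Q F X Y t I \<and> is_quadratic_covariation Q X Y t V \<and>
      (\<forall>\<omega>\<in>space Q. J \<omega> = I \<omega> + V \<omega> / 2))"

text \<open>\<open>I\<close> is a version of \<open>\<integral>\<^sub>0\<^sup>t B \<otimes> dB\<close>, respectively of \<open>\<integral>\<^sub>0\<^sup>t B \<otimes> \<circ>dB\<close>; all components are
  integrated with respect to the filtration generated by the whole vector \<open>B\<close>.\<close>

definition ito_tensor_integral ::
  "'b measure \<Rightarrow> (real \<Rightarrow> 'b \<Rightarrow> real ^ 'd) \<Rightarrow> real \<Rightarrow> ('b \<Rightarrow> real ^ 'd ^ 'd) \<Rightarrow> bool"
  where "ito_tensor_integral Q B t I \<longleftrightarrow>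
    (\<forall>i j. is_ito_integral Q (natural_filtration Q B)
      (\<lambda>s \<omega>. B s \<omega> $ i) (\<lambda>s \<omega>. B s \<omega> $ j) t (\<lambda>\<omega>. I \<omega> $ i $ j))"

definition stratonovich_tensor_integral ::
  "'b measure \<Rightarrow> (real \<Rightarrow> 'b \<Rightarrow> real ^ 'd) \<Rightarrow> real \<Rightarrow> ('b \<Rightarrow> real ^ 'd ^ 'd) \<Rightarrow> bool"
  where "stratonovich_tensor_integral Q B t J \<longleftrightarrow>
    (\<forall>i j. is_stratonovich_integral Q (natural_filtration Q B)
      (\<lambda>s \<omega>. B s \<omega> $ i) (\<lambda>s \<omega>. B s \<omega> $ j) t (\<lambda>\<omega>. J \<omega> $ i $ j))"


section \<open>Brownian rough paths and the iterated invariance principle\<close>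

definition brownian_rough_path ::
  "'b measure \<Rightarrow> (real \<Rightarrow> 'b \<Rightarrow> real ^ 'd) \<Rightarrow> (real \<Rightarrow> 'b \<Rightarrow> real ^ 'd ^ 'd) \<Rightarrow>
    real ^ 'd ^ 'd \<Rightarrow> real ^ 'd ^ 'd \<Rightarrow> bool"
  where "brownian_rough_path Q B BB \<Sigma> \<Gamma> \<longleftrightarrow>
    brownian_motion Q B \<Sigma> \<and>
    (\<forall>t\<ge>0. BB t \<in> borel_measurable Q \<and>
      (\<exists>I. ito_tensor_integral Q B t I \<and> (AE \<omega> in Q. BB t \<omega> = I \<omega> + t *\<^sub>R \<Gamma>)))"

definition iterated_invariance_principle ::
  "'a measure \<Rightarrow> (nat \<Rightarrow> real \<Rightarrow> 'a \<Rightarrow> real ^ 'd) \<Rightarrow> (nat \<Rightarrow> real \<Rightarrow> 'a \<Rightarrow> real ^ 'd ^ 'd) \<Rightarrow>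
    'b measure \<Rightarrow> (real \<Rightarrow> 'b \<Rightarrow> real ^ 'd) \<Rightarrow> (real \<Rightarrow> 'b \<Rightarrow> real ^ 'd ^ 'd) \<Rightarrow> bool"
  where "iterated_invariance_principle P S SS Q B BB \<longleftrightarrow>
    (\<exists>\<Sigma> \<Gamma>. brownian_rough_path Q B BB \<Sigma> \<Gamma>) \<and>
    (\<forall>N\<ge>1. \<forall>t\<ge>0. S N t \<in> borel_measurable P \<and> SS N t \<in> borel_measurable P) \<and>
    (\<forall>t\<ge>0. converges_in_law P (\<lambda>N \<omega>. (S N t \<omega>, SS N t \<omega>)) Q (\<lambda>\<omega>. (B t \<omega>, BB t \<omega>))) \<and>
    (\<forall>N\<ge>1. integrable P (\<lambda>\<omega>. S N 1 \<omega> \<otimes>\<^sub>T S N 1 \<omega>) \<and> integrable P (SS N 1)) \<and>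
    (\<lambda>N. \<integral>\<omega>. S N 1 \<omega> \<otimes>\<^sub>T S N 1 \<omega> \<partial>P) \<longlonglongrightarrow> (\<integral>\<omega>. B 1 \<omega> \<otimes>\<^sub>T B 1 \<omega> \<partial>Q) \<and>
    (\<lambda>N. \<integral>\<omega>. SS N 1 \<omega> \<partial>P) \<longlonglongrightarrow> (\<integral>\<omega>. BB 1 \<omega> \<partial>Q)"


section \<open>Suspensions\<close>

text \<open>Since \<open>(\<omega>, \<tau> \<omega>)\<close> is identified with \<open>(\<theta> \<omega>, 0)\<close>, every point of the suspension has exactly one
  representative \<open>(\<omega>, t)\<close> with \<open>0 \<le> t < \<tau> \<omega>\<close>; we work with these representatives.\<close>

definition suspension_space :: "'a measure \<Rightarrow> ('a \<Rightarrow> real) \<Rightarrow> ('a \<times> real) set"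
  where "suspension_space P \<tau> = {(\<omega>, t). \<omega> \<in> space P \<and> 0 \<le> t \<and> t < \<tau> \<omega>}"

definition suspension_measure :: "'a measure \<Rightarrow> ('a \<Rightarrow> real) \<Rightarrow> ('a \<times> real) measure"
  where "suspension_measure P \<tau> =
    scale_measure (ennreal (1 / (\<integral>\<omega>. \<tau> \<omega> \<partial>P)))
      (restrict_space (P \<Otimes>\<^sub>M lborel) (suspension_space P \<tau>))"

definition suspension_process ::
  "'a measure \<Rightarrow> ('a \<Rightarrow> 'a) \<Rightarrow> ('a \<Rightarrow> real) \<Rightarrow> (real \<Rightarrow> 'a \<times> real \<Rightarrow> real ^ 'd) \<Rightarrow> bool"
  where "suspension_process P \<theta> \<tau> \<Xi> \<longleftrightarrow>
    (\<forall>t\<ge>0. \<Xi> t \<in> borel_measurable (suspension_measure P \<tau>)) \<and>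
    (\<forall>t \<omega> s. 0 \<le> t \<longrightarrow> (\<omega>, s) \<in> suspension_space P \<tau> \<longrightarrow>
      (t + s < \<tau> \<omega> \<longrightarrow>
        \<Xi> t (\<omega>, s) = \<Xi> (t + s) (\<omega>, 0) \<and> \<Xi> (t + s) (\<omega>, 0) = \<Xi> 0 (\<omega>, t + s)) \<and>
      (\<forall>k\<ge>1. \<forall>u. 0 \<le> u \<longrightarrow> u < \<tau> ((\<theta> ^^ k) \<omega>) \<longrightarrow>
        t + s = u + (\<Sum>j<k. \<tau> ((\<theta> ^^ j) \<omega>)) \<longrightarrow>
        \<Xi> t (\<omega>, s) = \<Xi> 0 ((\<theta> ^^ k) \<omega>, u)))"

definition induced_process ::
  "('a \<Rightarrow> 'a) \<Rightarrow> ('a \<Rightarrow> real) \<Rightarrow> (real \<Rightarrow> 'a \<times> real \<Rightarrow> real ^ 'd) \<Rightarrow> nat \<Rightarrow> 'a \<Rightarrow> real ^ 'd"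
  where "induced_process \<theta> \<tau> \<Xi> k \<omega> =
    (LINT s:{0..\<tau> ((\<theta> ^^ k) \<omega>)}|lborel. \<Xi> s ((\<theta> ^^ k) \<omega>, 0))"

definition autocovariance :: "'a measure \<Rightarrow> (nat \<Rightarrow> 'a \<Rightarrow> real ^ 'd) \<Rightarrow> nat \<Rightarrow> real ^ 'd ^ 'd"
  where "autocovariance P \<xi> n = (\<integral>\<omega>. \<xi> 0 \<omega> \<otimes>\<^sub>T \<xi> n \<omega> \<partial>P)"

definition rescaled_sum ::
  "(nat \<Rightarrow> 'a \<Rightarrow> real ^ 'd) \<Rightarrow> nat \<Rightarrow> real \<Rightarrow> 'a \<Rightarrow> real ^ 'd"
  where "rescaled_sum \<xi> N t \<omega> = (1 / sqrt (real N)) *\<^sub>R (\<Sum>k<nat \<lfloor>real N * t\<rfloor>. \<xi> k \<omega>)"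

definition rescaled_iterated_sum ::
  "(nat \<Rightarrow> 'a \<Rightarrow> real ^ 'd) \<Rightarrow> nat \<Rightarrow> real \<Rightarrow> 'a \<Rightarrow> real ^ 'd ^ 'd"
  where "rescaled_iterated_sum \<xi> N t \<omega> =
    (1 / real N) *\<^sub>R (\<Sum>l<nat \<lfloor>real N * t\<rfloor>. \<Sum>k<l. \<xi> k \<omega> \<otimes>\<^sub>T \<xi> l \<omega>)"

definition rescaled_integral ::
  "(real \<Rightarrow> 'x \<Rightarrow> real ^ 'd) \<Rightarrow> nat \<Rightarrow> real \<Rightarrow> 'x \<Rightarrow> real ^ 'd"
  where "rescaled_integral \<Xi> N t x =
    (1 / sqrt (real N)) *\<^sub>R (LINT s:{0..real N * t}|lborel. \<Xi> s x)"

definition rescaled_iterated_integral ::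
  "(real \<Rightarrow> 'x \<Rightarrow> real ^ 'd) \<Rightarrow> nat \<Rightarrow> real \<Rightarrow> 'x \<Rightarrow> real ^ 'd ^ 'd"
  where "rescaled_iterated_integral \<Xi> N t x =
    (\<chi> i j. rs_integral 0 t
      (\<lambda>s. rescaled_integral \<Xi> N s x $ i) (\<lambda>s. rescaled_integral \<Xi> N s x $ j))"

text \<open>The integrand of the correction term, as a function of the point \<open>(\<omega>, u)\<close> of the suspension:
  \<open>(\<integral>\<^sub>0\<^sup>u \<Xi>(s; \<omega>) ds) \<otimes> \<Xi>(0; (\<omega>, u))\<close>.\<close>

definition roof_area :: "(real \<Rightarrow> 'a \<times> real \<Rightarrow> real ^ 'd) \<Rightarrow> 'a \<times> real \<Rightarrow> real ^ 'd ^ 'd"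
  where "roof_area \<Xi> = (\<lambda>(\<omega>, u). (LINT s:{0..u}|lborel. \<Xi> s (\<omega>, 0)) \<otimes>\<^sub>T \<Xi> 0 (\<omega>, u))"

end

theory Submission
  imports Defs
begin

text \<open>
  Everything except the area correction is close to being assumed: the limit \<open>Bbar\<close> is a Brownian
  motion with some covariance, and since \<open>Bbar t = \<tau>bar\<^sup>-\<^sup>1\<^sup>/\<^sup>2 B t\<close> almost surely, comparing second
  moments of one-dimensional projections forces that covariance to be \<open>\<Sigma> / \<tau>bar\<close>
  (\<open>brownian_motion_covariance_scaleR\<close>).

  The Stratonovich integral is the Ito integral plus half the quadratic covariation, and the quadratic
  covariation of a Brownian motion over \<open>[0, 1]\<close> is its covariance matrix
  (\<open>brownian_motion_quadratic_covariation\<close>).  So \<open>BBbar 1\<close> differs from the Stratonovich integral by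
  \<open>\<Gamma>bar - \<Sigma>bar / 2\<close>, and this is the antisymmetric part of \<open>\<Gamma>bar\<close> exactly when
  \<open>2 Sym \<Gamma>bar = \<Sigma>bar\<close> (\<open>brownian_rough_path_stratonovich\<close>).

  That identity is the heart of the matter.  Because \<open>\<Sigma> = \<Delta> 0 + 2 Sym \<Gamma>\<close>, it amounts to saying that
  twice the symmetric part of the roof correction is \<open>\<Delta> 0 / \<tau>bar\<close> (\<open>sym_part_mean_roof_area\<close>).
  Fubini reduces this to one fibre \<open>[0, \<tau> \<omega>)\<close>, where it is integration by parts: with
  \<open>F u = \<integral>\<^sub>0\<^sup>u \<Xi>(s; \<omega>) ds\<close>, the symmetrization of \<open>\<integral> F \<otimes> dF\<close> is \<open>F \<otimes> F\<close> at the end point \<open>\<tau> \<omega>\<close>,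
  that is \<open>\<xi> 0 \<otimes> \<xi> 0\<close>.  The symmetric part thus sees only the total displacement over an
  excursion, and a genuine correction can come only from the antisymmetric part.
\<close>


section \<open>Moments of Gaussian vectors\<close>


lemma centered_normal_law_moments:
  assumes "0 \<le> v"
  shows "has_bochner_integral (centered_normal_law v) (\<lambda>x. x ^ 2) v"
    and "has_bochner_integral (centered_normal_law v) (\<lambda>x. x ^ 4) (3 * v ^ 2)"
proof -
  have "has_bochner_integral (centered_normal_law v) (\<lambda>x. x ^ 2) v \<and>
    has_bochner_integral (centered_normal_law v) (\<lambda>x. x ^ 4) (3 * v ^ 2)"
  proof (cases "v = 0")
    case True
    have "has_bochner_integral (return borel (0::real)) (\<lambda>x::real. x ^ Suc k) 0" for k
    proof -
      have "AE x in return borel (0::real). x ^ Suc k = 0"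
        by (subst AE_return) auto
      then show ?thesis
        using has_bochner_integral_zero[of "return borel (0::real)"]
        by (subst has_bochner_integral_cong_AE[where g="\<lambda>_. 0"]) auto
    qed
    from this[of 1] this[of 3] show ?thesis
      using True by (simp add: centered_normal_law_def numeral_2_eq_2 numeral_eq_Suc)
  next
    case False
    with assms have v: "0 < v" by simp
    have even_moment:
      "has_bochner_integral (centered_normal_law v) (\<lambda>x. x ^ (2 * k))
        (fact (2 * k) / ((2 / v) ^ k * fact k))" for k
      using normal_moment_even[of "sqrt v" 0 k] v
      by (simp add: centered_normal_law_def has_bochner_integral_density normal_density_nonneg)
    from even_moment[of 1] even_moment[of 2] v show ?thesis
      by (simp add: fact_numeral power2_eq_square)
  qed
  then show "has_bochner_integral (centered_normal_law v) (\<lambda>x. x ^ 2) v"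
    and "has_bochner_integral (centered_normal_law v) (\<lambda>x. x ^ 4) (3 * v ^ 2)" by auto
qed

lemma centered_gaussian_moments:
  assumes "centered_gaussian Q X C"
  shows "has_bochner_integral Q (\<lambda>\<omega>. (u \<bullet> X \<omega>) ^ 2) (u \<bullet> (C *v u))"
    and "has_bochner_integral Q (\<lambda>\<omega>. (u \<bullet> X \<omega>) ^ 4) (3 * (u \<bullet> (C *v u)) ^ 2)"
proof -
  have X: "X \<in> borel_measurable Q" and nonneg: "0 \<le> u \<bullet> (C *v u)"
    and law: "distr Q borel (\<lambda>\<omega>. u \<bullet> X \<omega>) = centered_normal_law (u \<bullet> (C *v u))"
    using assms by (auto simp: centered_gaussian_def)
  have proj: "(\<lambda>\<omega>. u \<bullet> X \<omega>) \<in> measurable Q borel" using X by measurable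
  note distr_moments = centered_normal_law_moments[OF nonneg, folded law]
  show "has_bochner_integral Q (\<lambda>\<omega>. (u \<bullet> X \<omega>) ^ 2) (u \<bullet> (C *v u))"
    using distr_moments(1) by (simp add: has_bochner_integral_iff integral_distr[OF proj] integrable_distr_eq[OF proj])
  show "has_bochner_integral Q (\<lambda>\<omega>. (u \<bullet> X \<omega>) ^ 4) (3 * (u \<bullet> (C *v u)) ^ 2)"
    using distr_moments(2) by (simp add: has_bochner_integral_iff integral_distr[OF proj] integrable_distr_eq[OF proj])
qed

text \<open>Gaussian laws are known only through their projections, so mixed quantities have to be recovered
  from diagonal ones.\<close>

lemma symmetric_form_polarization:
  fixes C :: "real ^ 'd ^ 'd"
  assumes "transpose C = C"
  shows "2 * (u \<bullet> (C *v v)) = (u + v) \<bullet> (C *v (u + v)) - u \<bullet> (C *v u) - v \<bullet> (C *v v)"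
proof -
  have "v \<bullet> (C *v u) = u \<bullet> (C *v v)"
    using assms by (metis dot_lmul_matrix inner_commute transpose_matrix_vector)
  then show ?thesis
    by (simp add: matrix_vector_right_distrib inner_add_left inner_add_right)
qed

lemma form_axis_axis:
  fixes C :: "real ^ 'd ^ 'd"
  shows "axis i 1 \<bullet> (C *v axis j 1) = C $ i $ j"
  by (simp add: inner_axis' matrix_vector_mult_basis column_def)

lemma symmetric_matrix_eqI:
  fixes A C :: "real ^ 'd ^ 'd"
  assumes "transpose A = A" "transpose C = C"
    and "\<And>u. u \<bullet> (A *v u) = u \<bullet> (C *v u)"
  shows "A = C"
proof -
  have "u \<bullet> (A *v v) = u \<bullet> (C *v v)" for u v
    using symmetric_form_polarization[OF assms(1), of u v]
      symmetric_form_polarization[OF assms(2), of u v] assms(3) by simp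
  then show ?thesis by (metis form_axis_axis vec_eq_iff)
qed

text \<open>The two factors may be correlated, even equal.  The first moment comes from polarization; for the
  second moment a bound of the right order in the covariance is enough, and
  \<open>2 a\<^sup>2 b\<^sup>2 \<le> a\<^sup>4 + b\<^sup>4\<close> reduces it to fourth moments of projections.\<close>

lemma centered_gaussian_mixed_moments:
  assumes "centered_gaussian Q X C"
  shows "has_bochner_integral Q (\<lambda>\<omega>. (u \<bullet> X \<omega>) * (v \<bullet> X \<omega>)) (u \<bullet> (C *v v))"
    and "integrable Q (\<lambda>\<omega>. ((u \<bullet> X \<omega>) * (v \<bullet> X \<omega>)) ^ 2)"
    and "(\<integral>\<omega>. ((u \<bullet> X \<omega>) * (v \<bullet> X \<omega>)) ^ 2 \<partial>Q)
      \<le> 3 * ((u \<bullet> (C *v u)) ^ 2 + (v \<bullet> (C *v v)) ^ 2) / 2"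
proof -
  have X[measurable]: "X \<in> borel_measurable Q" and symm: "transpose C = C"
    using assms by (auto simp: centered_gaussian_def)
  note m2 = centered_gaussian_moments(1)[OF assms]
  note m4 = centered_gaussian_moments(2)[OF assms]
  have "has_bochner_integral Q
      (\<lambda>\<omega>. (((u + v) \<bullet> X \<omega>) ^ 2 - (u \<bullet> X \<omega>) ^ 2 - (v \<bullet> X \<omega>) ^ 2) / 2)
      (((u + v) \<bullet> (C *v (u + v)) - u \<bullet> (C *v u) - v \<bullet> (C *v v)) / 2)"
    by (intro has_bochner_integral_divide has_bochner_integral_diff m2)
  moreover have "(\<lambda>\<omega>. (((u + v) \<bullet> X \<omega>) ^ 2 - (u \<bullet> X \<omega>) ^ 2 - (v \<bullet> X \<omega>) ^ 2) / 2)
      = (\<lambda>\<omega>. (u \<bullet> X \<omega>) * (v \<bullet> X \<omega>))"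
    by (simp add: inner_add_left power2_eq_square algebra_simps)
  moreover have "((u + v) \<bullet> (C *v (u + v)) - u \<bullet> (C *v u) - v \<bullet> (C *v v)) / 2 = u \<bullet> (C *v v)"
    using symmetric_form_polarization[OF symm, of u v] by simp
  ultimately show "has_bochner_integral Q (\<lambda>\<omega>. (u \<bullet> X \<omega>) * (v \<bullet> X \<omega>)) (u \<bullet> (C *v v))"
    by simp
  have bound: "((u \<bullet> x) * (v \<bullet> x)) ^ 2 \<le> ((u \<bullet> x) ^ 4 + (v \<bullet> x) ^ 4) / 2" for x
  proof -
    have "0 \<le> ((u \<bullet> x) ^ 2 - (v \<bullet> x) ^ 2) ^ 2" by simp
    then show ?thesis by (simp add: power2_eq_square power4_eq_xxxx algebra_simps)
  qed
  have dom: "has_bochner_integral Q (\<lambda>\<omega>. ((u \<bullet> X \<omega>) ^ 4 + (v \<bullet> X \<omega>) ^ 4) / 2)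
      ((3 * (u \<bullet> (C *v u)) ^ 2 + 3 * (v \<bullet> (C *v v)) ^ 2) / 2)"
    by (intro has_bochner_integral_divide has_bochner_integral_add m4)
  show int: "integrable Q (\<lambda>\<omega>. ((u \<bullet> X \<omega>) * (v \<bullet> X \<omega>)) ^ 2)"
    by (rule Bochner_Integration.integrable_bound[OF integrable.intros[OF dom]])
      (use bound in \<open>auto simp: abs_of_nonneg intro!: always_eventually order_trans[OF bound]\<close>)
  have "(\<integral>\<omega>. ((u \<bullet> X \<omega>) * (v \<bullet> X \<omega>)) ^ 2 \<partial>Q)
      \<le> (\<integral>\<omega>. ((u \<bullet> X \<omega>) ^ 4 + (v \<bullet> X \<omega>) ^ 4) / 2 \<partial>Q)"
    using int dom by (intro integral_mono bound) (auto intro: integrable.intros)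
  then show "(\<integral>\<omega>. ((u \<bullet> X \<omega>) * (v \<bullet> X \<omega>)) ^ 2 \<partial>Q)
      \<le> 3 * ((u \<bullet> (C *v u)) ^ 2 + (v \<bullet> (C *v v)) ^ 2) / 2"
    using dom by (simp add: has_bochner_integral_iff)
qed


section \<open>Covariance and quadratic covariation of Brownian motion\<close>

text \<open>The cross terms of the expanded square vanish by pairwise independence.\<close>

lemma (in prob_space) second_moment_sum_indep_centered:
  fixes W :: "'k \<Rightarrow> 'a \<Rightarrow> real"
  assumes I: "finite I" and indep: "indep_vars (\<lambda>_. borel) W I"
    and sq: "\<And>k. k \<in> I \<Longrightarrow> integrable M (\<lambda>\<omega>. W k \<omega> ^ 2)"
    and centered: "\<And>k. k \<in> I \<Longrightarrow> has_bochner_integral M (W k) 0"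
  shows "has_bochner_integral M (\<lambda>\<omega>. (\<Sum>k\<in>I. W k \<omega>) ^ 2) (\<Sum>k\<in>I. expectation (\<lambda>\<omega>. W k \<omega> ^ 2))"
proof -
  have cross: "has_bochner_integral M (\<lambda>\<omega>. W k \<omega> * W l \<omega>)
      (if k = l then expectation (\<lambda>\<omega>. W k \<omega> ^ 2) else 0)" if kl: "k \<in> I" "l \<in> I" for k l
  proof (cases "k = l")
    case True
    then show ?thesis
      using sq[OF kl(1)] by (simp add: has_bochner_integral_iff power2_eq_square)
  next
    case False
    have indep_kl: "indep_vars (\<lambda>_. borel) W {k, l}"
      using indep by (rule indep_vars_subset) (use kl in auto)
    have int: "integrable M (W m)" "expectation (W m) = 0" if "m \<in> {k, l}" for m
      using centered[of m] kl that by (auto simp: has_bochner_integral_iff)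
    show ?thesis
      using indep_vars_integrable[OF _ indep_kl int(1)]
        indep_vars_lebesgue_integral[OF _ indep_kl int(1)] False int(2)
      by (simp add: has_bochner_integral_iff)
  qed
  have "has_bochner_integral M (\<lambda>\<omega>. \<Sum>k\<in>I. \<Sum>l\<in>I. W k \<omega> * W l \<omega>)
      (\<Sum>k\<in>I. \<Sum>l\<in>I. if k = l then expectation (\<lambda>\<omega>. W k \<omega> ^ 2) else 0)"
    by (intro has_bochner_integral_sum cross)
  moreover have "(\<Sum>k\<in>I. \<Sum>l\<in>I. if k = l then expectation (\<lambda>\<omega>. W k \<omega> ^ 2) else 0)
      = (\<Sum>k\<in>I. expectation (\<lambda>\<omega>. W k \<omega> ^ 2))"
    by (rule sum.cong) (simp_all add: I)
  ultimately show ?thesis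
    by (simp add: power2_eq_square sum_product)
qed

text \<open>The increment over \<open>[0, 1]\<close> determines the covariance matrix, and its quadratic form is the second
  moment of the projections, which scales by \<open>c\<^sup>2\<close>.\<close>

lemma brownian_motion_covariance_scaleR:
  assumes B: "brownian_motion Q B \<Sigma>" and B': "brownian_motion Q B' \<Sigma>'"
    and eq: "\<forall>t\<ge>0. AE \<omega> in Q. B' t \<omega> = c *\<^sub>R B t \<omega>"
  shows "\<Sigma>' = c\<^sup>2 *\<^sub>R \<Sigma>"
proof (rule symmetric_matrix_eqI)
  let ?X = "\<lambda>\<omega>. B 1 \<omega> - B 0 \<omega>" and ?X' = "\<lambda>\<omega>. B' 1 \<omega> - B' 0 \<omega>"
  have "centered_gaussian Q ?X ((1 - 0) *\<^sub>R \<Sigma>)" "centered_gaussian Q ?X' ((1 - 0) *\<^sub>R \<Sigma>')"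
    using B B' unfolding brownian_motion_def by (meson order_refl zero_le_one)+
  then have X: "centered_gaussian Q ?X \<Sigma>" and X': "centered_gaussian Q ?X' \<Sigma>'" by auto
  then have [measurable]: "?X \<in> borel_measurable Q" "?X' \<in> borel_measurable Q"
    and symm: "transpose \<Sigma> = \<Sigma>"
    by (auto simp: centered_gaussian_def)
  show "transpose \<Sigma>' = \<Sigma>'" using X' by (simp add: centered_gaussian_def)
  show "transpose (c\<^sup>2 *\<^sub>R \<Sigma>) = c\<^sup>2 *\<^sub>R \<Sigma>"
    using symm by (simp add: vec_eq_iff transpose_def)
  fix u
  have "AE \<omega> in Q. ?X' \<omega> = c *\<^sub>R ?X \<omega>"
    using eq[rule_format, OF zero_le_one] eq[rule_format, OF order_refl]
    by eventually_elim (simp add: scaleR_diff_right)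
  then have "(\<integral>\<omega>. (u \<bullet> ?X' \<omega>) ^ 2 \<partial>Q) = (\<integral>\<omega>. c\<^sup>2 * (u \<bullet> ?X \<omega>) ^ 2 \<partial>Q)"
    by (intro integral_cong_AE) (auto simp: power_mult_distrib)
  then show "u \<bullet> (\<Sigma>' *v u) = u \<bullet> (c\<^sup>2 *\<^sub>R \<Sigma> *v u)"
    using centered_gaussian_moments(1)[OF X, of u] centered_gaussian_moments(1)[OF X', of u]
    by (simp add: has_bochner_integral_iff scaleR_matrix_vector_assoc[symmetric])
qed

lemma partition_step_le_mesh:
  assumes "k < n" shows "p (Suc k) - p k \<le> mesh n p"
  unfolding mesh_def using assms by (intro Max_ge) auto

lemma partition_nonneg:
  assumes "is_partition 0 t n p" "k \<le> n" shows "0 \<le> p k"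
  using assms(2)
proof (induction k)
  case (Suc k)
  then have "0 \<le> p k" "p k \<le> p (Suc k)" using assms(1) by (auto simp: is_partition_def)
  then show ?case by linarith
qed (use assms(1) in \<open>simp add: is_partition_def\<close>)

text \<open>One term of a quadratic covariation sum, centred.  Its second moment is quadratic in the length
  of the time step; summed over a partition this yields a factor of the mesh.\<close>

lemma brownian_increment_product_moments:
  fixes i j :: "'d::finite" and B :: "real \<Rightarrow> 'b \<Rightarrow> real ^ 'd"
  assumes B: "brownian_motion Q B \<Sigma>" and st: "0 \<le> s" "s \<le> t"
  defines "W \<equiv> \<lambda>\<omega>. (B t \<omega> - B s \<omega>) $ i * (B t \<omega> - B s \<omega>) $ j - (t - s) * \<Sigma> $ i $ j"
  shows "has_bochner_integral Q W 0"
    and "integrable Q (\<lambda>\<omega>. W \<omega> ^ 2)"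
    and "(\<integral>\<omega>. W \<omega> ^ 2 \<partial>Q) \<le> 3 * ((\<Sigma> $ i $ i)\<^sup>2 + (\<Sigma> $ j $ j)\<^sup>2) / 2 * (t - s)\<^sup>2"
proof -
  interpret prob_space Q using B by (simp add: brownian_motion_def)
  define Z where "Z = (\<lambda>\<omega>. (B t \<omega> - B s \<omega>) $ i * (B t \<omega> - B s \<omega>) $ j)"
  define m where "m = (t - s) * \<Sigma> $ i $ j"
  have W_eq: "W = (\<lambda>\<omega>. Z \<omega> - m)" by (simp add: W_def Z_def m_def)
  have "centered_gaussian Q (\<lambda>\<omega>. B t \<omega> - B s \<omega>) ((t - s) *\<^sub>R \<Sigma>)"
    using B st by (simp add: brownian_motion_def)
  from centered_gaussian_mixed_moments[OF this, of "axis i 1" "axis j 1"]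
  have Z: "has_bochner_integral Q Z m" and Z2: "integrable Q (\<lambda>\<omega>. Z \<omega> ^ 2)"
    and Z2_le: "(\<integral>\<omega>. Z \<omega> ^ 2 \<partial>Q)
      \<le> 3 * (((t - s) * \<Sigma> $ i $ i)\<^sup>2 + ((t - s) * \<Sigma> $ j $ j)\<^sup>2) / 2"
    unfolding form_axis_axis by (simp_all add: Z_def m_def inner_axis')
  have int_Z: "integrable Q Z" and exp_Z: "expectation Z = m"
    using Z by (auto simp: has_bochner_integral_iff)
  show "has_bochner_integral Q W 0"
    using int_Z exp_Z prob_space by (simp add: W_eq has_bochner_integral_iff)
  have W2: "W \<omega> ^ 2 = Z \<omega> ^ 2 - 2 * m * Z \<omega> + m\<^sup>2" for \<omega>
    by (simp add: W_eq power2_eq_square algebra_simps)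
  show "integrable Q (\<lambda>\<omega>. W \<omega> ^ 2)"
    unfolding W2 using Z2 int_Z by auto
  have "(\<integral>\<omega>. W \<omega> ^ 2 \<partial>Q) = (\<integral>\<omega>. Z \<omega> ^ 2 \<partial>Q) - m\<^sup>2"
    unfolding W2 using Z2 int_Z exp_Z prob_space by (simp add: power2_eq_square)
  also have "\<dots> \<le> (\<integral>\<omega>. Z \<omega> ^ 2 \<partial>Q)" by simp
  also note Z2_le
  finally show "(\<integral>\<omega>. W \<omega> ^ 2 \<partial>Q) \<le> 3 * ((\<Sigma> $ i $ i)\<^sup>2 + (\<Sigma> $ j $ j)\<^sup>2) / 2 * (t - s)\<^sup>2"
    by (simp only: power_mult_distrib) argo
qed

text \<open>The centred terms are independent, so the second moment of their sum is at most
  \<open>K \<Sum>(\<Delta>t)\<^sup>2 \<le> K t \<cdot> mesh\<close>.  Hence the sums converge in mean square, and by Chebyshev's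
  inequality in probability.\<close>

theorem brownian_motion_quadratic_covariation:
  assumes B: "brownian_motion Q B \<Sigma>"
  shows "is_quadratic_covariation Q (\<lambda>s \<omega>. B s \<omega> $ i) (\<lambda>s \<omega>. B s \<omega> $ j) t (\<lambda>_. t * \<Sigma> $ i $ j)"
  unfolding is_quadratic_covariation_def
proof (intro conjI allI impI)
  interpret prob_space Q using B by (simp add: brownian_motion_def)
  fix n :: "nat \<Rightarrow> nat" and p :: "nat \<Rightarrow> nat \<Rightarrow> real"
  assume part: "\<forall>m. is_partition 0 t (n m) (p m)" and mesh: "(\<lambda>m. mesh (n m) (p m)) \<longlonglongrightarrow> 0"
  define K where "K = 3 * ((\<Sigma> $ i $ i)\<^sup>2 + (\<Sigma> $ j $ j)\<^sup>2) / 2"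
  have K: "0 \<le> K" by (simp add: K_def)
  define \<Delta>B where "\<Delta>B m k \<omega> = B (p m (Suc k)) \<omega> - B (p m k) \<omega>" for m k \<omega>
  define W where "W m k \<omega> = \<Delta>B m k \<omega> $ i * \<Delta>B m k \<omega> $ j - (p m (Suc k) - p m k) * \<Sigma> $ i $ j" for m k \<omega>
  let ?S = "\<lambda>m \<omega>. \<Sum>k<n m. W m k \<omega>"
  have telescope: "(\<Sum>k<n m. p m (Suc k) - p m k) = t" for m
    using part by (simp add: sum_lessThan_telescope is_partition_def)
  have second_moment: "integrable Q (\<lambda>\<omega>. ?S m \<omega> ^ 2)"
    "(\<integral>\<omega>. ?S m \<omega> ^ 2 \<partial>Q) \<le> K * t * mesh (n m) (p m)"
    "?S m \<in> borel_measurable Q" for m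
  proof -
    have step: "0 \<le> p m k" "p m k \<le> p m (Suc k)" if "k < n m" for k
      using part that partition_nonneg[of t "n m" "p m" k] by (auto simp: is_partition_def)
    have "indep_vars (\<lambda>_. borel) (\<Delta>B m) {..<n m}"
    proof -
      have "0 \<le> p m 0" "\<forall>k<n m. p m k \<le> p m (Suc k)"
        using part by (auto simp: is_partition_def)
      with B show ?thesis unfolding brownian_motion_def \<Delta>B_def by blast
    qed
    then have indep: "indep_vars (\<lambda>_. borel) (W m) {..<n m}"
      unfolding W_def
      by (rule indep_vars_compose2
          [where Y="\<lambda>k x. x $ i * x $ j - (p m (Suc k) - p m k) * \<Sigma> $ i $ j"])
        measurable
    have W: "has_bochner_integral Q (W m k) 0" "integrable Q (\<lambda>\<omega>. W m k \<omega> ^ 2)"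
      "(\<integral>\<omega>. W m k \<omega> ^ 2 \<partial>Q) \<le> K * (p m (Suc k) - p m k)\<^sup>2" if "k < n m" for k
      using brownian_increment_product_moments[OF B step[OF that], of i j]
      unfolding W_def \<Delta>B_def K_def by blast+
    note sum_W = second_moment_sum_indep_centered[OF _ indep, simplified, OF W(2,1)]
    show "integrable Q (\<lambda>\<omega>. ?S m \<omega> ^ 2)" using sum_W by (simp add: has_bochner_integral_iff)
    show "?S m \<in> borel_measurable Q"
      using W(1) by (intro borel_measurable_sum) (auto simp: has_bochner_integral_iff)
    have "(\<integral>\<omega>. ?S m \<omega> ^ 2 \<partial>Q) = (\<Sum>k<n m. \<integral>\<omega>. W m k \<omega> ^ 2 \<partial>Q)"
      using sum_W by (simp add: has_bochner_integral_iff)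
    also have "\<dots> \<le> (\<Sum>k<n m. K * ((p m (Suc k) - p m k) * mesh (n m) (p m)))"
    proof (rule sum_mono)
      fix k assume "k \<in> {..<n m}"
      then have k: "k < n m" by simp
      have "(p m (Suc k) - p m k)\<^sup>2 \<le> (p m (Suc k) - p m k) * mesh (n m) (p m)"
        unfolding power2_eq_square using step[OF k] partition_step_le_mesh[OF k, of "p m"]
        by (intro mult_left_mono) auto
      then show "(\<integral>\<omega>. W m k \<omega> ^ 2 \<partial>Q) \<le> K * ((p m (Suc k) - p m k) * mesh (n m) (p m))"
        using W(3)[OF k] mult_left_mono[OF _ K] by fastforce
    qed
    also have "\<dots> = K * t * mesh (n m) (p m)"
      by (simp add: telescope sum_distrib_left[symmetric] sum_distrib_right[symmetric])
    finally show "(\<integral>\<omega>. ?S m \<omega> ^ 2 \<partial>Q) \<le> K * t * mesh (n m) (p m)" .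
  qed
  have drift: "(\<Sum>k<n m. (p m (Suc k) - p m k) * \<Sigma> $ i $ j) = t * \<Sigma> $ i $ j" for m
    unfolding sum_distrib_right[symmetric] telescope ..
  have S_eq: "?S m \<omega> = (\<Sum>k<n m. (B (p m (Suc k)) \<omega> $ i - B (p m k) \<omega> $ i) *
      (B (p m (Suc k)) \<omega> $ j - B (p m k) \<omega> $ j)) - t * \<Sigma> $ i $ j" for m \<omega>
    unfolding drift[of m, symmetric] sum_subtractf[symmetric] W_def \<Delta>B_def vector_minus_component ..
  show "converges_in_probability Q
      (\<lambda>m \<omega>. \<Sum>k<n m. (B (p m (Suc k)) \<omega> $ i - B (p m k) \<omega> $ i) *
        (B (p m (Suc k)) \<omega> $ j - B (p m k) \<omega> $ j)) (\<lambda>_. t * \<Sigma> $ i $ j)"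
    unfolding converges_in_probability_def S_eq[symmetric]
  proof (intro allI impI)
    fix \<epsilon> :: real assume \<epsilon>: "\<epsilon> > 0"
    have bound: "measure Q {\<omega> \<in> space Q. \<epsilon> \<le> \<bar>?S m \<omega>\<bar>} \<le> K * t * mesh (n m) (p m) / \<epsilon>\<^sup>2" for m
    proof -
      have "measure Q {\<omega> \<in> space Q. \<epsilon> \<le> \<bar>?S m \<omega>\<bar>} \<le> (\<integral>\<omega>. ?S m \<omega> ^ 2 \<partial>Q) / \<epsilon>\<^sup>2"
        by (rule second_moment_method[OF second_moment(3,1) \<epsilon>])
      also have "\<dots> \<le> K * t * mesh (n m) (p m) / \<epsilon>\<^sup>2"
        by (rule divide_right_mono[OF second_moment(2)]) simp
      finally show ?thesis .
    qed
    have lim: "(\<lambda>m. K * t * mesh (n m) (p m) / \<epsilon>\<^sup>2) \<longlonglongrightarrow> 0"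
      using tendsto_mult_right_zero[OF mesh, of "K * t / \<epsilon>\<^sup>2"]
      by (simp only: times_divide_eq_left)
    show "(\<lambda>m. measure Q {\<omega> \<in> space Q. \<epsilon> \<le> \<bar>?S m \<omega>\<bar>}) \<longlonglongrightarrow> 0"
      by (rule tendsto_sandwich[OF always_eventually always_eventually tendsto_const lim])
        (intro allI measure_nonneg bound)+
  qed
qed simp


section \<open>Integration by parts for primitives\<close>

lemma integrable_product_lborel:
  fixes f g :: "real \<Rightarrow> real"
  assumes f: "integrable lborel f" and g: "integrable lborel g"
  shows "integrable (lborel \<Otimes>\<^sub>M lborel) (\<lambda>(s, u). f s * g u)"
proof -
  have [measurable]: "f \<in> borel_measurable borel" "g \<in> borel_measurable borel"
    using f g by auto
  show ?thesis
    using f g by (intro lborel_pair.Fubini_integrable) (auto simp: abs_mult)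
qed

text \<open>The primitives of \<open>f\<close> and \<open>g\<close> are only absolutely continuous.  The two terms on the left are the
  integrals of \<open>f s * g u\<close> over the half planes \<open>s \<le> u\<close> and \<open>s > u\<close>, so that Fubini's theorem
  makes them add up to the full product.\<close>

lemma integral_by_parts_primitive:
  fixes f g :: "real \<Rightarrow> real"
  assumes f: "integrable lborel f" and g: "integrable lborel g"
  shows "(\<integral>u. (\<integral>s. indicator {..u} s * f s \<partial>lborel) * g u \<partial>lborel) +
      (\<integral>u. (\<integral>s. indicator {..u} s * g s \<partial>lborel) * f u \<partial>lborel)
    = (\<integral>s. f s \<partial>lborel) * (\<integral>u. g u \<partial>lborel)"
proof -
  have [measurable]: "f \<in> borel_measurable borel" "g \<in> borel_measurable borel"
    using f g by auto
  let ?A = "\<lambda>s u. indicator {..u} s * (f s * g u)"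
  let ?D = "\<lambda>s u. indicator {u<..} s * (f s * g u)"
  note prod = integrable_product_lborel[OF f g]
  have A: "integrable (lborel \<Otimes>\<^sub>M lborel) (case_prod ?A)"
    by (rule Bochner_Integration.integrable_bound[OF prod])
      (auto simp: indicator_def intro!: always_eventually)
  have D: "integrable (lborel \<Otimes>\<^sub>M lborel) (case_prod ?D)"
    by (rule Bochner_Integration.integrable_bound[OF prod])
      (auto simp: indicator_def intro!: always_eventually)
  have "(\<integral>u. (\<integral>s. indicator {..u} s * f s \<partial>lborel) * g u \<partial>lborel)
      = integral\<^sup>L (lborel \<Otimes>\<^sub>M lborel) (case_prod ?A)"
    by (subst lborel_pair.integral_snd[OF A, symmetric])
      (simp add: mult.assoc[symmetric])
  moreover have "(\<integral>u. (\<integral>s. indicator {..u} s * g s \<partial>lborel) * f u \<partial>lborel)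
      = integral\<^sup>L (lborel \<Otimes>\<^sub>M lborel) (case_prod ?D)"
  proof -
    \<comment> \<open>Dropping the point \<open>u\<close> makes the two half planes disjoint.\<close>
    have "(\<integral>s. indicator {..u} s * g s \<partial>lborel) = (\<integral>s. indicator {..<u} s * g s \<partial>lborel)" for u
      by (rule integral_discrete_difference[of "{u}"]) (auto simp: indicator_def)
    then show ?thesis
      by (subst lborel_pair.integral_fst[OF D, symmetric])
        (auto intro!: Bochner_Integration.integral_cong
          simp: indicator_def Bochner_Integration.integral_mult_left_zero[symmetric] mult_ac
          simp del: Bochner_Integration.integral_mult_left_zero)
  qed
  moreover have "integral\<^sup>L (lborel \<Otimes>\<^sub>M lborel) (case_prod ?A)
      + integral\<^sup>L (lborel \<Otimes>\<^sub>M lborel) (case_prod ?D)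
      = integral\<^sup>L (lborel \<Otimes>\<^sub>M lborel) (\<lambda>(s, u). f s * g u)"
    by (subst Bochner_Integration.integral_add[OF A D, symmetric])
      (auto intro!: Bochner_Integration.integral_cong simp: indicator_def)
  moreover have "\<dots> = (\<integral>s. f s \<partial>lborel) * (\<integral>u. g u \<partial>lborel)"
    by (subst lborel_pair.integral_fst[OF prod, symmetric]) simp
  ultimately show ?thesis by simp
qed

text \<open>The outer integral runs over a half-open interval because a fibre of the suspension does not
  contain its end point.\<close>

lemma set_integral_by_parts_primitive:
  fixes f g :: "real \<Rightarrow> real"
  assumes f: "set_integrable lborel {0..c} f" and g: "set_integrable lborel {0..c} g"
  shows "(LINT u:{0..<c}|lborel. (LINT s:{0..u}|lborel. f s) * g u) +
      (LINT u:{0..<c}|lborel. (LINT s:{0..u}|lborel. g s) * f u)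
    = (LINT s:{0..c}|lborel. f s) * (LINT u:{0..c}|lborel. g u)"
proof -
  let ?cut = "\<lambda>f s. indicator {0..c} s * f s"
  have iterated: "(LINT u:{0..<c}|lborel. (LINT s:{0..u}|lborel. f s) * g u)
      = (\<integral>u. (\<integral>s. indicator {..u} s * ?cut f s \<partial>lborel) * ?cut g u \<partial>lborel)"
    for f g :: "real \<Rightarrow> real"
  proof -
    have primitive: "(LINT s:{0..u}|lborel. f s) = (\<integral>s. indicator {..u} s * ?cut f s \<partial>lborel)"
      if "u \<in> {0..c}" for u
      unfolding set_lebesgue_integral_def
      by (rule Bochner_Integration.integral_cong) (use that in \<open>auto simp: indicator_def\<close>)
    have "(LINT u:{0..<c}|lborel. (LINT s:{0..u}|lborel. f s) * g u)
        = (LINT u:{0..c}|lborel. (LINT s:{0..u}|lborel. f s) * g u)"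
      unfolding set_lebesgue_integral_def
      by (rule integral_discrete_difference[of "{c}"]) (auto simp: indicator_def)
    also have "\<dots> = (\<integral>u. (\<integral>s. indicator {..u} s * ?cut f s \<partial>lborel) * ?cut g u \<partial>lborel)"
      unfolding set_lebesgue_integral_def[of _ "{0..c}"]
      by (rule Bochner_Integration.integral_cong) (auto simp: primitive indicator_def)
    finally show ?thesis .
  qed
  show ?thesis
    using integral_by_parts_primitive[of "?cut f" "?cut g"] f g
    unfolding iterated by (simp add: set_integrable_def set_lebesgue_integral_def)
qed


section \<open>The mean roof area\<close>

lemma scale_measure_eq_density: "scale_measure r M = density M (\<lambda>_. r)"
  by (rule measure_eqI) (simp_all add: emeasure_density nn_integral_cmult_indicator)

lemma suspension_space_measurable:
  assumes [measurable]: "\<tau> \<in> borel_measurable P"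
  shows "suspension_space P \<tau> \<in> sets (P \<Otimes>\<^sub>M lborel)"
proof -
  have "suspension_space P \<tau> = {x \<in> space (P \<Otimes>\<^sub>M lborel). 0 \<le> snd x \<and> snd x < \<tau> (fst x)}"
    by (auto simp: suspension_space_def space_pair_measure)
  also have "\<dots> \<in> sets (P \<Otimes>\<^sub>M lborel)" by measurable
  finally show ?thesis .
qed

lemma suspension_measure_fubini:
  fixes h :: "'a \<times> real \<Rightarrow> 'c::{banach, second_countable_topology}"
  assumes "sigma_finite_measure P"
    and \<tau>: "\<tau> \<in> borel_measurable P" and mean: "(\<integral>\<omega>. \<tau> \<omega> \<partial>P) > 0"
    and h: "integrable (suspension_measure P \<tau>) h"
  shows "integrable P (\<lambda>\<omega>. LINT u:{0..<\<tau> \<omega>}|lborel. h (\<omega>, u))"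
    and "AE \<omega> in P. set_integrable lborel {0..<\<tau> \<omega>} (\<lambda>u. h (\<omega>, u))"
    and "integral\<^sup>L (suspension_measure P \<tau>) h =
      (1 / (\<integral>\<omega>. \<tau> \<omega> \<partial>P)) *\<^sub>R (\<integral>\<omega>. (LINT u:{0..<\<tau> \<omega>}|lborel. h (\<omega>, u)) \<partial>P)"
proof -
  interpret P: sigma_finite_measure P by fact
  interpret pair_sigma_finite P lborel ..
  let ?S = "suspension_space P \<tau>" and ?R = "restrict_space (P \<Otimes>\<^sub>M lborel) (suspension_space P \<tau>)"
  let ?r = "1 / (\<integral>\<omega>. \<tau> \<omega> \<partial>P)" and ?g = "\<lambda>x. indicator ?S x *\<^sub>R h x"
  have r: "?r > 0" using mean by simp
  have S: "?S \<inter> space (P \<Otimes>\<^sub>M lborel) \<in> sets (P \<Otimes>\<^sub>M lborel)"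
    using suspension_space_measurable[OF \<tau>] by auto
  have Pbar: "suspension_measure P \<tau> = density ?R (\<lambda>_. ennreal ?r)"
    by (simp add: suspension_measure_def scale_measure_eq_density)
  have "h \<in> borel_measurable (suspension_measure P \<tau>)" using h by auto
  then have h_meas: "h \<in> borel_measurable ?R" unfolding Pbar by simp
  have "integrable ?R (\<lambda>x. ?r *\<^sub>R h x)"
    using h r unfolding Pbar by (subst (asm) integrable_density) (auto intro: h_meas)
  from integrable_scaleR_right[OF this, of "inverse ?r"] have "integrable ?R h" using r by simp
  then have g: "integrable (P \<Otimes>\<^sub>M lborel) ?g" by (simp add: integrable_restrict_space[OF S])
  have slice: "?g (\<omega>, u) = indicator {0..<\<tau> \<omega>} u *\<^sub>R h (\<omega>, u)" if "\<omega> \<in> space P" for \<omega> u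
    using that by (simp add: suspension_space_def indicator_def)
  have slice_integral: "(\<integral>u. ?g (\<omega>, u) \<partial>lborel) = (LINT u:{0..<\<tau> \<omega>}|lborel. h (\<omega>, u))"
    if "\<omega> \<in> space P" for \<omega>
    using that by (simp add: slice set_lebesgue_integral_def)
  show "integrable P (\<lambda>\<omega>. LINT u:{0..<\<tau> \<omega>}|lborel. h (\<omega>, u))"
    using integrable_fst'[OF g] by (subst (asm) Bochner_Integration.integrable_cong[OF refl slice_integral])
  show "AE \<omega> in P. set_integrable lborel {0..<\<tau> \<omega>} (\<lambda>u. h (\<omega>, u))"
    using AE_integrable_fst'[OF g] AE_space
    by eventually_elim (simp add: slice set_integrable_def)
  have "integral\<^sup>L (suspension_measure P \<tau>) h = (\<integral>x. ?r *\<^sub>R h x \<partial>?R)"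
    unfolding Pbar using r by (subst integral_density) (auto intro: h_meas)
  also have "\<dots> = ?r *\<^sub>R (\<integral>\<omega>. (\<integral>u. ?g (\<omega>, u) \<partial>lborel) \<partial>P)"
    by (simp add: integral_restrict_space[OF S] integral_fst'[OF g])
  also have "(\<integral>\<omega>. (\<integral>u. ?g (\<omega>, u) \<partial>lborel) \<partial>P) = (\<integral>\<omega>. (LINT u:{0..<\<tau> \<omega>}|lborel. h (\<omega>, u)) \<partial>P)"
    by (rule Bochner_Integration.integral_cong) (simp_all only: slice_integral)
  finally show "integral\<^sup>L (suspension_measure P \<tau>) h =
      ?r *\<^sub>R (\<integral>\<omega>. (LINT u:{0..<\<tau> \<omega>}|lborel. h (\<omega>, u)) \<partial>P)" .
qed


text \<open>On the fibre over \<open>\<omega>\<close> the process \<open>\<Xi> 0 (\<omega>, u)\<close> is the density of the primitive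
  \<open>u \<mapsto> \<integral>\<^sub>0\<^sup>u \<Xi>(s; \<omega>) ds\<close>, so \<open>A\<close> is the iterated integral of that primitive against itself.\<close>

lemma roof_area_slice:
  fixes \<Xi> :: "real \<Rightarrow> 'a \<times> real \<Rightarrow> real ^ 'd"
  assumes \<Xi>: "suspension_process P \<theta> \<tau> \<Xi>" and \<omega>: "\<omega> \<in> space P" "0 < \<tau> \<omega>"
    and int: "set_integrable lborel {0..\<tau> \<omega>} (\<lambda>s. \<Xi> s (\<omega>, 0))"
    and area: "set_integrable lborel {0..<\<tau> \<omega>} (\<lambda>u. roof_area \<Xi> (\<omega>, u))"
  defines "A \<equiv> LINT u:{0..<\<tau> \<omega>}|lborel. roof_area \<Xi> (\<omega>, u)"
  shows "A + transpose A =
    (LINT s:{0..\<tau> \<omega>}|lborel. \<Xi> s (\<omega>, 0)) \<otimes>\<^sub>T (LINT s:{0..\<tau> \<omega>}|lborel. \<Xi> s (\<omega>, 0))"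
proof -
  let ?f = "\<lambda>i s. \<Xi> s (\<omega>, 0) $ i"
  have current: "\<Xi> 0 (\<omega>, u) = \<Xi> u (\<omega>, 0)" if "u \<in> {0..<\<tau> \<omega>}" for u
  proof -
    have "(\<omega>, 0) \<in> suspension_space P \<tau>" using \<omega> by (simp add: suspension_space_def)
    then show ?thesis
      using \<Xi> that unfolding suspension_process_def by (metis add.right_neutral atLeastLessThan_iff)
  qed
  have coord: "set_integrable lborel I (\<lambda>s. h s $ i)"
    "(LINT s:I|lborel. h s) $ i = (LINT s:I|lborel. h s $ i)"
    if "set_integrable lborel I h" for I i and h :: "real \<Rightarrow> 'e::euclidean_space ^ 'd"
    using that integral_bounded_linear[OF bounded_linear_vec_nth, of lborel "\<lambda>s. indicator I s *\<^sub>R h s" i]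
      integrable_bounded_linear[OF bounded_linear_vec_nth, of lborel "\<lambda>s. indicator I s *\<^sub>R h s" i]
    by (simp_all add: set_integrable_def set_lebesgue_integral_def)
  have f: "set_integrable lborel {0..u} (\<lambda>s. \<Xi> s (\<omega>, 0))" if "u \<in> {0..\<tau> \<omega>}" for u
    using that by (intro set_integrable_subset[OF int]) auto
  have A: "A $ i $ j = (LINT u:{0..<\<tau> \<omega>}|lborel. (LINT s:{0..u}|lborel. ?f i s) * ?f j u)" for i j
    unfolding A_def coord(2)[OF area] coord(2)[OF coord(1)[OF area]]
    by (rule set_lebesgue_integral_cong) (simp_all add: roof_area_def tensor_def current coord(2)[OF f])
  show ?thesis
    unfolding vec_eq_iff
  proof (intro allI)
    fix i j
    show "(A + transpose A) $ i $ j =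
      ((LINT s:{0..\<tau> \<omega>}|lborel. \<Xi> s (\<omega>, 0)) \<otimes>\<^sub>T (LINT s:{0..\<tau> \<omega>}|lborel. \<Xi> s (\<omega>, 0))) $ i $ j"
      using set_integral_by_parts_primitive[OF coord(1)[OF int, of i] coord(1)[OF int, of j]]
      by (simp add: A transpose_def tensor_def coord(2)[OF int])
  qed
qed

lemma bounded_linear_transpose:
  "bounded_linear (transpose :: real ^ 'd ^ 'd \<Rightarrow> real ^ 'd ^ 'd)"
  by (rule linear_conv_bounded_linear[THEN iffD1])
    (auto intro!: linearI simp: transpose_def vec_eq_iff)

text \<open>Averaging the fibrewise identity over \<open>P\<close>; the factor in front is the normalization of the
  suspension measure.\<close>

lemma sym_part_mean_roof_area:
  fixes \<Xi> :: "real \<Rightarrow> 'a \<times> real \<Rightarrow> real ^ 'd"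
  assumes "sigma_finite_measure P"
    and \<tau>: "\<tau> \<in> borel_measurable P" "\<forall>\<omega>\<in>space P. 0 < \<tau> \<omega>" "0 < (\<integral>\<omega>. \<tau> \<omega> \<partial>P)"
    and \<Xi>: "suspension_process P \<theta> \<tau> \<Xi>"
    and int: "AE \<omega> in P. set_integrable lborel {0..\<tau> \<omega>} (\<lambda>s. \<Xi> s (\<omega>, 0))"
    and area: "integrable (suspension_measure P \<tau>) (roof_area \<Xi>)"
    and var: "integrable P (\<lambda>\<omega>. induced_process \<theta> \<tau> \<Xi> 0 \<omega> \<otimes>\<^sub>T induced_process \<theta> \<tau> \<Xi> 0 \<omega>)"
  shows "2 *\<^sub>R sym_part (\<integral>x. roof_area \<Xi> x \<partial>suspension_measure P \<tau>)
    = (1 / (\<integral>\<omega>. \<tau> \<omega> \<partial>P)) *\<^sub>R autocovariance P (induced_process \<theta> \<tau> \<Xi>) 0"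
proof -
  define H where "H \<omega> = (LINT u:{0..<\<tau> \<omega>}|lborel. roof_area \<Xi> (\<omega>, u))" for \<omega>
  note fubini = suspension_measure_fubini[OF assms(1) \<tau>(1,3) area, folded H_def]
  have HT: "integrable P (\<lambda>\<omega>. transpose (H \<omega>))"
    "(\<integral>\<omega>. transpose (H \<omega>) \<partial>P) = transpose (\<integral>\<omega>. H \<omega> \<partial>P)"
    using fubini(1) by (auto intro: integrable_bounded_linear integral_bounded_linear bounded_linear_transpose)
  have "AE \<omega> in P. H \<omega> + transpose (H \<omega>)
      = induced_process \<theta> \<tau> \<Xi> 0 \<omega> \<otimes>\<^sub>T induced_process \<theta> \<tau> \<Xi> 0 \<omega>"
    using int fubini(2) AE_space
    by eventually_elim (use \<tau>(2) in \<open>simp add: H_def induced_process_def roof_area_slice[OF \<Xi>]\<close>)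
  then have "(\<integral>\<omega>. H \<omega> + transpose (H \<omega>) \<partial>P) = autocovariance P (induced_process \<theta> \<tau> \<Xi>) 0"
    unfolding autocovariance_def using fubini(1) HT(1) var by (intro integral_cong_AE) auto
  then have "(\<integral>\<omega>. H \<omega> \<partial>P) + transpose (\<integral>\<omega>. H \<omega> \<partial>P) = autocovariance P (induced_process \<theta> \<tau> \<Xi>) 0"
    using fubini(1) HT by simp
  moreover have "transpose (r *\<^sub>R M) = r *\<^sub>R transpose M" for r and M :: "real ^ 'd ^ 'd"
    by (simp add: transpose_def vec_eq_iff)
  ultimately show ?thesis
    unfolding fubini(3) sym_part_def by (simp add: scaleR_add_right[symmetric])
qed


section \<open>The area correction\<close>

lemma sym_part_plus_anti_part: "sym_part M + anti_part M = M"
  by (simp add: sym_part_def anti_part_def vec_eq_iff field_simps)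

text \<open>The hypothesis on \<open>\<Gamma>\<close> says that the Ito-Stratonovich correction \<open>t \<Sigma> / 2\<close> absorbs
  all of \<open>t Sym \<Gamma>\<close>.\<close>

theorem brownian_rough_path_stratonovich:
  assumes BB: "brownian_rough_path Q B BB \<Sigma> \<Gamma>" and sym: "2 *\<^sub>R sym_part \<Gamma> = \<Sigma>" and t: "0 \<le> t"
  shows "\<exists>J. stratonovich_tensor_integral Q B t J \<and> (AE \<omega> in Q. BB t \<omega> = J \<omega> + t *\<^sub>R anti_part \<Gamma>)"
proof -
  have B: "brownian_motion Q B \<Sigma>" using BB by (simp add: brownian_rough_path_def)
  obtain I where I: "ito_tensor_integral Q B t I" and BB_eq: "AE \<omega> in Q. BB t \<omega> = I \<omega> + t *\<^sub>R \<Gamma>"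
    using BB t by (auto simp: brownian_rough_path_def)
  define J where "J \<omega> = I \<omega> + (t / 2) *\<^sub>R \<Sigma>" for \<omega>
  have "stratonovich_tensor_integral Q B t J"
    unfolding stratonovich_tensor_integral_def is_stratonovich_integral_def
  proof (intro allI exI conjI)
    fix i j
    show "is_ito_integral Q (natural_filtration Q B) (\<lambda>s \<omega>. B s \<omega> $ i) (\<lambda>s \<omega>. B s \<omega> $ j) t (\<lambda>\<omega>. I \<omega> $ i $ j)"
      using I by (simp add: ito_tensor_integral_def)
    show "is_quadratic_covariation Q (\<lambda>s \<omega>. B s \<omega> $ i) (\<lambda>s \<omega>. B s \<omega> $ j) t (\<lambda>_. t * \<Sigma> $ i $ j)"
      by (rule brownian_motion_quadratic_covariation[OF B])
  qed (simp add: J_def)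
  moreover have "\<Gamma> = (1/2) *\<^sub>R \<Sigma> + anti_part \<Gamma>"
    using sym_part_plus_anti_part[of \<Gamma>] by (simp add: sym[symmetric])
  then have "I \<omega> + t *\<^sub>R \<Gamma> = J \<omega> + t *\<^sub>R anti_part \<Gamma>" for \<omega>
    by (metis (no_types, lifting) J_def add.assoc mult.right_neutral scaleR_add_right scaleR_scaleR
        times_divide_eq_right)
  ultimately show ?thesis using BB_eq by auto
qed


theorem theorem4:
  fixes P :: "'a measure" and \<theta> :: "'a \<Rightarrow> 'a" and \<tau> :: "'a \<Rightarrow> real" and L :: real
    and \<Xi> :: "real \<Rightarrow> 'a \<times> real \<Rightarrow> real ^ 'd"
    and \<xi> :: "nat \<Rightarrow> 'a \<Rightarrow> real ^ 'd" and \<Delta> :: "nat \<Rightarrow> real ^ 'd ^ 'd"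
    and \<tau>bar :: real and Pbar :: "('a \<times> real) measure"
    and Q :: "'b measure"
    and B Bbar :: "real \<Rightarrow> 'b \<Rightarrow> real ^ 'd"
    and BB BBbar :: "real \<Rightarrow> 'b \<Rightarrow> real ^ 'd ^ 'd"
    and \<Sigma> \<Gamma> \<Sigma>bar \<Gamma>bar :: "real ^ 'd ^ 'd"
  assumes P: "prob_space P" "complete_measure P"
    and \<theta>: "\<theta> \<in> measurable P P" "distr P P \<theta> = P"
    and \<tau>: "\<tau> \<in> borel_measurable P" "L > 0" "\<forall>\<omega>\<in>space P. 1 / L \<le> \<tau> \<omega> \<and> \<tau> \<omega> \<le> L"
    and \<tau>bar: "\<tau>bar = (\<integral>\<omega>. \<tau> \<omega> \<partial>P)"
    and Pbar: "Pbar = suspension_measure P \<tau>"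
    and \<Xi>: "suspension_process P \<theta> \<tau> \<Xi>"
    and \<Xi>_integrable: "AE \<omega> in P. set_integrable lborel {0..\<tau> \<omega>} (\<lambda>s. \<Xi> s (\<omega>, 0))"
    and area_integrable: "integrable Pbar (roof_area \<Xi>)"
    and \<xi>: "\<xi> = induced_process \<theta> \<tau> \<Xi>"
    and \<Delta>: "\<Delta> = autocovariance P \<xi>"
    and \<xi>_centered: "integrable P (\<xi> 0)" "(\<integral>\<omega>. \<xi> 0 \<omega> \<partial>P) = 0"
    and \<Delta>_finite: "\<forall>n. integrable P (\<lambda>\<omega>. \<xi> 0 \<omega> \<otimes>\<^sub>T \<xi> n \<omega>)" "summable (\<lambda>n. \<Delta> (Suc n))"
    and \<Gamma>: "\<Gamma> = (\<Sum>n. \<Delta> (Suc n))"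
    and \<Sigma>: "\<Sigma> = \<Delta> 0 + 2 *\<^sub>R sym_part \<Gamma>"
    and discrete_limit:
      "iterated_invariance_principle P (rescaled_sum \<xi>) (rescaled_iterated_sum \<xi>) Q B BB"
      "brownian_rough_path Q B BB \<Sigma> \<Gamma>"
    and continuous_limit:
      "iterated_invariance_principle Pbar (rescaled_integral \<Xi>) (rescaled_iterated_integral \<Xi>)
        Q Bbar BBbar"
    and Bbar: "\<forall>t\<ge>0. AE \<omega> in Q. Bbar t \<omega> = (\<tau>bar powr (-1/2)) *\<^sub>R B t \<omega>"
    and BBbar: "\<forall>t\<ge>0. \<exists>I. ito_tensor_integral Q Bbar t I \<and>
      (AE \<omega> in Q. BBbar t \<omega> =
        I \<omega> + t *\<^sub>R (1 / \<tau>bar) *\<^sub>R \<Gamma> + t *\<^sub>R (\<integral>x. roof_area \<Xi> x \<partial>Pbar))"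
    and \<Sigma>bar: "\<Sigma>bar = (1 / \<tau>bar) *\<^sub>R \<Sigma>"
    and \<Gamma>bar: "\<Gamma>bar = (1 / \<tau>bar) *\<^sub>R \<Gamma> + (\<integral>x. roof_area \<Xi> x \<partial>Pbar)"
  shows "brownian_rough_path Q Bbar BBbar \<Sigma>bar \<Gamma>bar \<and>
    (\<exists>J. stratonovich_tensor_integral Q Bbar 1 J \<and>
      (AE \<omega> in Q. BBbar 1 \<omega> = J \<omega> + anti_part \<Gamma>bar))"
proof -
  interpret P: prob_space P by fact
  have pos: "0 < 1 / L" "\<forall>\<omega>\<in>space P. 0 < \<tau> \<omega>"
    using \<tau>(2,3) by (auto intro: less_le_trans[of 0 "1 / L"])
  have "integrable P \<tau>"
    using \<tau> by (intro P.integrable_const_bound[of _ L])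
      (auto intro!: AE_I2 simp: abs_of_pos[OF pos(2)[rule_format]])
  then have "1 / L \<le> \<tau>bar"
    unfolding \<tau>bar using \<tau>(3) by (intro P.integral_ge_const) (auto intro: AE_I2)
  with pos(1) have \<tau>bar_pos: "0 < \<tau>bar" by linarith
  have "(\<tau>bar powr (-1/2))\<^sup>2 = 1 / \<tau>bar"
    using \<tau>bar_pos by (simp add: power2_eq_square powr_add[symmetric] powr_minus_divide)
  moreover obtain \<Sigma>' \<Gamma>' where limit: "brownian_rough_path Q Bbar BBbar \<Sigma>' \<Gamma>'"
    using continuous_limit by (auto simp: iterated_invariance_principle_def)
  moreover have "brownian_motion Q B \<Sigma>" using discrete_limit(2) by (simp add: brownian_rough_path_def)
  ultimately have "\<Sigma>' = \<Sigma>bar"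
    using brownian_motion_covariance_scaleR[OF _ _ Bbar] by (simp add: \<Sigma>bar brownian_rough_path_def)
  with limit BBbar have path: "brownian_rough_path Q Bbar BBbar \<Sigma>bar \<Gamma>bar"
    by (simp add: brownian_rough_path_def \<Gamma>bar scaleR_add_right add.assoc)
  have "2 *\<^sub>R sym_part (\<integral>x. roof_area \<Xi> x \<partial>Pbar) = (1 / \<tau>bar) *\<^sub>R \<Delta> 0"
    using sym_part_mean_roof_area[OF P.sigma_finite_measure_axioms \<tau>(1) pos(2) _ \<Xi> \<Xi>_integrable]
      area_integrable \<Delta>_finite(1) \<tau>bar_pos
    by (simp add: Pbar \<tau>bar \<Delta> \<xi>)
  moreover have "2 *\<^sub>R sym_part \<Gamma>bar
      = (1 / \<tau>bar) *\<^sub>R (2 *\<^sub>R sym_part \<Gamma>) + 2 *\<^sub>R sym_part (\<integral>x. roof_area \<Xi> x \<partial>Pbar)"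
    by (simp add: \<Gamma>bar sym_part_def transpose_def vec_eq_iff field_simps)
  ultimately have "2 *\<^sub>R sym_part \<Gamma>bar = \<Sigma>bar"
    by (simp add: \<Sigma>bar \<Sigma> scaleR_add_right)
  with path brownian_rough_path_stratonovich[OF path _ zero_le_one] show ?thesis by simp
qed

end
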